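(* If $A$ is a subresiduated lattice, then $\langle \mathrm{K}(A),\wedge,\vee,\Rightarrow,\sim,(0,1),(1,0)\rangle$ is a subresiduated Nelson algebra.
   Context: A subresiduated lattice (sr-lattice) is an algebra $\langle A,\wedge,\vee,\to,0,1\rangle$ of type $(2,2,2,0,0)$ such that $\langle A,\wedge,\vee,0,1\rangle$ is a bounded distributive lattice and for all $a,b,c\in A$: $(a\vee b)\to c=(a\to c)\wedge(b\to c)$; $c\to(a\wedge b)=(c\to a)\wedge(c\to b)$; $(a\to b)\wedge(b\to c)\le a\to c$; $a\to a=1$; $a\wedge(a\to b)\le b$; $a\to b\le c\to(a\to b)$. For an sr-lattice $A$, $\mathrm{K}(A)=\{(a,b)\in A\times A: a\wedge b=0\}$, with operations $(a,b)\wedge(c,d)=(a\wedge c,b\vee d)$, $(a,b)\vee(c,d)=(a\vee c,b\wedge d)$, $\sim(a,b)=(b,a)$, $(a,b)\Rightarrow(c,d)=(a\to c,a\wedge d)$, least element $(0,1)$ and greatest element $(1,0)$. A Kleene algebra is a bounded distributive lattice $\langle T,\wedge,\vee,0,1\rangle$ with a unary operation $\sim$ satisfying $\sim\sim x=x$, $\sim(x\wedge y)=\sim x\vee\sim y$, $(x\wedge\sim x)\wedge(y\vee\sim y)=x\wedge\sim x$. A subresiduated Nelson algebra is an algebra $\langle T,\wedge,\vee,\to,\sim,0,1\rangle$ of type $(2,2,2,1,0,0)$ such that $\langle T,\wedge,\vee,\sim,0,1\rangle$ is a Kleene algebra and for all $x,y,z\in T$: (1) $(x\vee y)\to z=(x\to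 z)\wedge(y\to z)$; (2) $z\to(x\wedge y)=(z\to x)\wedge(z\to y)$; (3) $((x\to y)\wedge(y\to z))\to(x\to z)=1$; (4) $x\to x=1$; (5) $x\wedge(x\to y)\le x\wedge(\sim x\vee y)$; (6) $x\to y\le z\to(x\to y)$; (7) $\sim(x\to y)\to(x\wedge\sim y)=1$; (8) $(x\wedge\sim y)\to\sim(x\to y)=1$. (For $\mathrm{K}(A)$ the implication is $\Rightarrow$, $0$ is $(0,1)$ and $1$ is $(1,0)$.) *)

theory Defs
  imports Main
begin

text \<open>Algebras are given by an explicit carrier set together with their operations; the operations
  are only constrained on the carrier.\<close>

locale bounded_distributive_lattice =
  fixes L :: "'a set"
    and meet :: "'a \<Rightarrow> 'a \<Rightarrow> 'a" (infixl "\<sqinter>" 70)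
    and join :: "'a \<Rightarrow> 'a \<Rightarrow> 'a" (infixl "\<squnion>" 65)
    and zero :: "'a" ("\<zero>")
    and one :: "'a" ("\<one>")
  assumes meet_closed: "\<lbrakk>x \<in> L; y \<in> L\<rbrakk> \<Longrightarrow> x \<sqinter> y \<in> L"
    and join_closed: "\<lbrakk>x \<in> L; y \<in> L\<rbrakk> \<Longrightarrow> x \<squnion> y \<in> L"
    and zero_closed: "\<zero> \<in> L"
    and one_closed: "\<one> \<in> L"
    and meet_assoc: "\<lbrakk>x \<in> L; y \<in> L; z \<in> L\<rbrakk> \<Longrightarrow> (x \<sqinter> y) \<sqinter> z = x \<sqinter> (y \<sqinter> z)"
    and join_assoc: "\<lbrakk>x \<in> L; y \<in> L; z \<in> L\<rbrakk> \<Longrightarrow> (x \<squnion> y) \<squnion> z = x \<squnion> (y \<squnion> z)"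
    and meet_commute: "\<lbrakk>x \<in> L; y \<in> L\<rbrakk> \<Longrightarrow> x \<sqinter> y = y \<sqinter> x"
    and join_commute: "\<lbrakk>x \<in> L; y \<in> L\<rbrakk> \<Longrightarrow> x \<squnion> y = y \<squnion> x"
    and meet_join_absorb: "\<lbrakk>x \<in> L; y \<in> L\<rbrakk> \<Longrightarrow> x \<sqinter> (x \<squnion> y) = x"
    and join_meet_absorb: "\<lbrakk>x \<in> L; y \<in> L\<rbrakk> \<Longrightarrow> x \<squnion> (x \<sqinter> y) = x"
    and meet_join_distrib:
      "\<lbrakk>x \<in> L; y \<in> L; z \<in> L\<rbrakk> \<Longrightarrow> x \<sqinter> (y \<squnion> z) = (x \<sqinter> y) \<squnion> (x \<sqinter> z)"
    and zero_least: "x \<in> L \<Longrightarrow> \<zero> \<sqinter> x = \<zero>"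
    and one_greatest: "x \<in> L \<Longrightarrow> x \<sqinter> \<one> = x"
begin

abbreviation le :: "'a \<Rightarrow> 'a \<Rightarrow> bool" (infix "\<sqsubseteq>" 50)
  where "x \<sqsubseteq> y \<equiv> x \<sqinter> y = x"

end

locale subresiduated_lattice = bounded_distributive_lattice A meet join zero one
  for A :: "'a set"
    and meet :: "'a \<Rightarrow> 'a \<Rightarrow> 'a" (infixl "\<sqinter>" 70)
    and join :: "'a \<Rightarrow> 'a \<Rightarrow> 'a" (infixl "\<squnion>" 65)
    and imp :: "'a \<Rightarrow> 'a \<Rightarrow> 'a" (infixr "\<rightarrow>" 60)
    and zero :: "'a" ("\<zero>")
    and one :: "'a" ("\<one>") +
  assumes imp_closed: "\<lbrakk>a \<in> A; b \<in> A\<rbrakk> \<Longrightarrow> a \<rightarrow> b \<in> A"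
    and join_imp: "\<lbrakk>a \<in> A; b \<in> A; c \<in> A\<rbrakk> \<Longrightarrow> (a \<squnion> b) \<rightarrow> c = (a \<rightarrow> c) \<sqinter> (b \<rightarrow> c)"
    and imp_meet: "\<lbrakk>a \<in> A; b \<in> A; c \<in> A\<rbrakk> \<Longrightarrow> c \<rightarrow> (a \<sqinter> b) = (c \<rightarrow> a) \<sqinter> (c \<rightarrow> b)"
    and imp_trans: "\<lbrakk>a \<in> A; b \<in> A; c \<in> A\<rbrakk> \<Longrightarrow> (a \<rightarrow> b) \<sqinter> (b \<rightarrow> c) \<sqsubseteq> a \<rightarrow> c"
    and imp_refl: "a \<in> A \<Longrightarrow> a \<rightarrow> a = \<one>"
    and modus_ponens: "\<lbrakk>a \<in> A; b \<in> A\<rbrakk> \<Longrightarrow> a \<sqinter> (a \<rightarrow> b) \<sqsubseteq> b"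
    and imp_weaken: "\<lbrakk>a \<in> A; b \<in> A; c \<in> A\<rbrakk> \<Longrightarrow> a \<rightarrow> b \<sqsubseteq> c \<rightarrow> (a \<rightarrow> b)"

locale kleene_algebra = bounded_distributive_lattice T meet join zero one
  for T :: "'a set"
    and meet :: "'a \<Rightarrow> 'a \<Rightarrow> 'a" (infixl "\<sqinter>" 70)
    and join :: "'a \<Rightarrow> 'a \<Rightarrow> 'a" (infixl "\<squnion>" 65)
    and neg :: "'a \<Rightarrow> 'a" ("\<sim> _" [80] 80)
    and zero :: "'a" ("\<zero>")
    and one :: "'a" ("\<one>") +
  assumes neg_closed: "x \<in> T \<Longrightarrow> \<sim> x \<in> T"
    and neg_neg: "x \<in> T \<Longrightarrow> \<sim> (\<sim> x) = x"
    and neg_meet: "\<lbrakk>x \<in> T; y \<in> T\<rbrakk> \<Longrightarrow> \<sim> (x \<sqinter> y) = \<sim> x \<squnion> \<sim> y"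
    and kleene: "\<lbrakk>x \<in> T; y \<in> T\<rbrakk> \<Longrightarrow> (x \<sqinter> \<sim> x) \<sqinter> (y \<squnion> \<sim> y) = x \<sqinter> \<sim> x"

locale subresiduated_nelson_algebra = kleene_algebra T meet join neg zero one
  for T :: "'a set"
    and meet :: "'a \<Rightarrow> 'a \<Rightarrow> 'a" (infixl "\<sqinter>" 70)
    and join :: "'a \<Rightarrow> 'a \<Rightarrow> 'a" (infixl "\<squnion>" 65)
    and imp :: "'a \<Rightarrow> 'a \<Rightarrow> 'a" (infixr "\<rightarrow>" 60)
    and neg :: "'a \<Rightarrow> 'a" ("\<sim> _" [80] 80)
    and zero :: "'a" ("\<zero>")
    and one :: "'a" ("\<one>") +
  assumes imp_closed: "\<lbrakk>x \<in> T; y \<in> T\<rbrakk> \<Longrightarrow> x \<rightarrow> y \<in> T"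
    and join_imp: "\<lbrakk>x \<in> T; y \<in> T; z \<in> T\<rbrakk> \<Longrightarrow> (x \<squnion> y) \<rightarrow> z = (x \<rightarrow> z) \<sqinter> (y \<rightarrow> z)"
    and imp_meet: "\<lbrakk>x \<in> T; y \<in> T; z \<in> T\<rbrakk> \<Longrightarrow> z \<rightarrow> (x \<sqinter> y) = (z \<rightarrow> x) \<sqinter> (z \<rightarrow> y)"
    and imp_trans:
      "\<lbrakk>x \<in> T; y \<in> T; z \<in> T\<rbrakk> \<Longrightarrow> ((x \<rightarrow> y) \<sqinter> (y \<rightarrow> z)) \<rightarrow> (x \<rightarrow> z) = \<one>"
    and imp_refl: "x \<in> T \<Longrightarrow> x \<rightarrow> x = \<one>"
    and modus_ponens: "\<lbrakk>x \<in> T; y \<in> T\<rbrakk> \<Longrightarrow> x \<sqinter> (x \<rightarrow> y) \<sqsubseteq> x \<sqinter> (\<sim> x \<squnion> y)"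
    and imp_weaken: "\<lbrakk>x \<in> T; y \<in> T; z \<in> T\<rbrakk> \<Longrightarrow> x \<rightarrow> y \<sqsubseteq> z \<rightarrow> (x \<rightarrow> y)"
    and neg_imp_to_meet: "\<lbrakk>x \<in> T; y \<in> T\<rbrakk> \<Longrightarrow> \<sim> (x \<rightarrow> y) \<rightarrow> (x \<sqinter> \<sim> y) = \<one>"
    and meet_to_neg_imp: "\<lbrakk>x \<in> T; y \<in> T\<rbrakk> \<Longrightarrow> (x \<sqinter> \<sim> y) \<rightarrow> \<sim> (x \<rightarrow> y) = \<one>"

definition K_carrier :: "'a set \<Rightarrow> ('a \<Rightarrow> 'a \<Rightarrow> 'a) \<Rightarrow> 'a \<Rightarrow> ('a \<times> 'a) set"
  where "K_carrier A meet zero = {(a, b). a \<in> A \<and> b \<in> A \<and> meet a b = zero}"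

definition K_meet ::
    "('a \<Rightarrow> 'a \<Rightarrow> 'a) \<Rightarrow> ('a \<Rightarrow> 'a \<Rightarrow> 'a) \<Rightarrow> 'a \<times> 'a \<Rightarrow> 'a \<times> 'a \<Rightarrow> 'a \<times> 'a"
  where "K_meet meet join = (\<lambda>(a, b) (c, d). (meet a c, join b d))"

definition K_join ::
    "('a \<Rightarrow> 'a \<Rightarrow> 'a) \<Rightarrow> ('a \<Rightarrow> 'a \<Rightarrow> 'a) \<Rightarrow> 'a \<times> 'a \<Rightarrow> 'a \<times> 'a \<Rightarrow> 'a \<times> 'a"
  where "K_join meet join = (\<lambda>(a, b) (c, d). (join a c, meet b d))"

definition K_imp ::
    "('a \<Rightarrow> 'a \<Rightarrow> 'a) \<Rightarrow> ('a \<Rightarrow> 'a \<Rightarrow> 'a) \<Rightarrow> 'a \<times> 'a \<Rightarrow> 'a \<times> 'a \<Rightarrow> 'a \<times> 'a"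
  where "K_imp meet imp = (\<lambda>(a, b) (c, d). (imp a c, meet a d))"

definition K_neg :: "'a \<times> 'a \<Rightarrow> 'a \<times> 'a"
  where "K_neg = (\<lambda>(a, b). (b, a))"

end

theory Submission
  imports Defs
begin

text \<open>
  A pair \<open>(a, b)\<close> of \<open>K(A)\<close> records disjoint positive and negative information about a proposition.
  Everything except the implication is symmetric in the two coordinates: \<open>K(A)\<close> is a sublattice of
  the product of \<open>A\<close> with its order dual, and negation swaps the factors.  That part only uses that
  \<open>A\<close> is a bounded distributive lattice; the Kleene inequality holds because \<open>x \<sqinter> \<sim> x\<close> always has
  first coordinate zero and \<open>y \<squnion> \<sim> y\<close> always has second coordinate zero
  (\<open>K_kleene_algebra\<close>).

  For the implication, the first coordinate of each Nelson identity reduces to a law of \<open>A\<close>, with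
  one exception: Nelson modus ponens has the extra disjunct \<open>b\<close> on its right-hand side, which is
  harmless because \<open>b\<close> is disjoint from the antecedent \<open>a\<close>.  The identities that equate an
  implication with the top element hold because \<open>(a, b) \<Rightarrow> (c, d)\<close> is the top element exactly when
  \<open>a \<sqsubseteq> c\<close> and \<open>a \<sqinter> d\<close> is zero (\<open>imp_eq_one_if_le\<close> gives the direction that is used).  When such
  a meet contains an implication, modus ponens in \<open>A\<close> makes it zero: \<open>a \<sqinter> (a \<rightarrow> c)\<close> lies below \<open>c\<close>,
  so it is disjoint from everything that is disjoint from \<open>c\<close> (\<open>meet_imp_disjoint\<close>).
\<close>

section \<open>Bounded distributive lattices on a carrier\<close>

context bounded_distributive_lattice
begin

lemma meet_left_commute:
  "\<lbrakk>x \<in> L; y \<in> L; z \<in> L\<rbrakk> \<Longrightarrow> x \<sqinter> (y \<sqinter> z) = y \<sqinter> (x \<sqinter> z)"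
  by (metis meet_assoc meet_commute)

lemma meet_idem: "x \<in> L \<Longrightarrow> x \<sqinter> x = x"
  by (metis join_meet_absorb meet_closed meet_join_absorb)

lemma join_idem: "x \<in> L \<Longrightarrow> x \<squnion> x = x"
  by (metis join_meet_absorb meet_idem)

lemma meet_zero: "x \<in> L \<Longrightarrow> x \<sqinter> \<zero> = \<zero>"
  by (metis meet_commute zero_closed zero_least)

lemma join_zero: "x \<in> L \<Longrightarrow> x \<squnion> \<zero> = x"
  by (metis join_meet_absorb meet_zero zero_closed)

lemma zero_join: "x \<in> L \<Longrightarrow> \<zero> \<squnion> x = x"
  by (metis join_commute join_zero zero_closed)

lemma one_join: "x \<in> L \<Longrightarrow> \<one> \<squnion> x = \<one>"
  by (metis join_meet_absorb meet_commute one_closed one_greatest)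

lemma join_meet_distrib_right:
  "\<lbrakk>x \<in> L; y \<in> L; z \<in> L\<rbrakk> \<Longrightarrow> (x \<squnion> y) \<sqinter> z = (x \<sqinter> z) \<squnion> (y \<sqinter> z)"
  by (simp add: meet_commute meet_join_distrib join_closed)

text \<open>The axioms contain only one distributive law; the second coordinate of a distributivity
  identity in \<open>K\<close> is its order dual.\<close>

lemma join_meet_distrib:
  assumes "x \<in> L" "y \<in> L" "z \<in> L"
  shows "x \<squnion> (y \<sqinter> z) = (x \<squnion> y) \<sqinter> (x \<squnion> z)"
proof -
  have "(x \<squnion> y) \<sqinter> (x \<squnion> z) = (x \<sqinter> (x \<squnion> z)) \<squnion> (y \<sqinter> (x \<squnion> z))"
    using assms by (simp add: join_meet_distrib_right join_closed)
  also have "\<dots> = x \<squnion> ((x \<sqinter> y) \<squnion> (y \<sqinter> z))"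
    using assms by (simp add: meet_join_absorb meet_join_distrib meet_commute[of y x])
  also have "\<dots> = x \<squnion> (y \<sqinter> z)"
    using assms by (simp add: join_assoc[symmetric] join_meet_absorb meet_closed)
  finally show ?thesis ..
qed

text \<open>\<open>K\<close> of a bounded distributive lattice is closed under the lattice operations because meets
  distribute over joins: what is disjoint from \<open>b\<close> and from \<open>d\<close> is disjoint from \<open>b \<squnion> d\<close>.\<close>

lemma meet_join_disjoint:
  assumes "a \<in> L" "b \<in> L" "c \<in> L" "d \<in> L" "a \<sqinter> b = \<zero>" "c \<sqinter> d = \<zero>"
  shows "(a \<sqinter> c) \<sqinter> (b \<squnion> d) = \<zero>"
proof -
  have "(a \<sqinter> c) \<sqinter> b = c \<sqinter> (a \<sqinter> b)" "(a \<sqinter> c) \<sqinter> d = a \<sqinter> (c \<sqinter> d)"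
    using assms(1-4) by (simp_all add: meet_assoc meet_left_commute)
  then show ?thesis
    using assms by (simp add: meet_join_distrib meet_closed meet_zero join_zero zero_closed)
qed

section \<open>The Kleene algebra of disjoint pairs\<close>

lemma K_kleene_algebra:
  "kleene_algebra (K_carrier L meet \<zero>) (K_meet meet join) (K_join meet join) K_neg
     (\<zero>, \<one>) (\<one>, \<zero>)"
proof -
  have join_meet_disjoint: "(a \<squnion> c) \<sqinter> (b \<sqinter> d) = \<zero>"
    if "a \<in> L" "b \<in> L" "c \<in> L" "d \<in> L" "a \<sqinter> b = \<zero>" "c \<sqinter> d = \<zero>" for a b c d
    using meet_join_disjoint[of b a d c] that
    by (metis meet_commute join_closed meet_closed)
  note K_defs = K_carrier_def K_meet_def K_join_def K_neg_def
  show ?thesis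
  proof
    fix x y
    assume "x \<in> K_carrier L meet \<zero>" "y \<in> K_carrier L meet \<zero>"
    then obtain a b c d where x: "x = (a, b)" and y: "y = (c, d)"
      and mem: "a \<in> L" "b \<in> L" "c \<in> L" "d \<in> L"
      and ab: "a \<sqinter> b = \<zero>" and cd: "c \<sqinter> d = \<zero>"
      by (auto simp: K_carrier_def)
    show "K_meet meet join x y \<in> K_carrier L meet \<zero>"
      "K_join meet join x y \<in> K_carrier L meet \<zero>"
      using mem ab cd
      by (simp_all add: x y K_defs meet_closed join_closed meet_join_disjoint join_meet_disjoint)
    show "K_meet meet join x y = K_meet meet join y x"
      "K_join meet join x y = K_join meet join y x"
      using mem by (simp_all add: x y K_defs meet_commute[of a c] meet_commute[of b d]
        join_commute[of a c] join_commute[of b d])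
    show "K_meet meet join x (K_join meet join x y) = x"
      "K_join meet join x (K_meet meet join x y) = x"
      using mem by (simp_all add: x y K_defs meet_join_absorb join_meet_absorb)
    show "K_neg (K_meet meet join x y) = K_join meet join (K_neg x) (K_neg y)"
      by (simp add: x y K_defs)
    have "b \<sqinter> a = \<zero>" "d \<sqinter> c = \<zero>"
      using mem ab cd by (simp_all add: meet_commute)
    then show "K_meet meet join (K_meet meet join x (K_neg x)) (K_join meet join y (K_neg y))
      = K_meet meet join x (K_neg x)"
      using mem ab by (simp add: x y K_defs zero_least join_zero join_closed)
  next
    fix x y z
    assume "x \<in> K_carrier L meet \<zero>" "y \<in> K_carrier L meet \<zero>" "z \<in> K_carrier L meet \<zero>"
    then show "K_meet meet join (K_meet meet join x y) z = K_meet meet join x (K_meet meet join y z)"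
      "K_join meet join (K_join meet join x y) z = K_join meet join x (K_join meet join y z)"
      "K_meet meet join x (K_join meet join y z)
        = K_join meet join (K_meet meet join x y) (K_meet meet join x z)"
      by (auto simp: K_defs meet_assoc join_assoc meet_join_distrib join_meet_distrib)
  next
    fix x
    assume "x \<in> K_carrier L meet \<zero>"
    then obtain a b where x: "x = (a, b)" and mem: "a \<in> L" "b \<in> L" and ab: "a \<sqinter> b = \<zero>"
      by (auto simp: K_carrier_def)
    show "K_neg x \<in> K_carrier L meet \<zero>"
      using mem ab by (simp add: x K_defs meet_commute)
    show "K_neg (K_neg x) = x"
      by (simp add: x K_defs)
    show "K_meet meet join (\<zero>, \<one>) x = (\<zero>, \<one>)" "K_meet meet join x (\<one>, \<zero>) = x"
      using mem by (simp_all add: x K_defs zero_least one_join one_greatest join_zero)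
  next
    show "(\<zero>, \<one>) \<in> K_carrier L meet \<zero>" "(\<one>, \<zero>) \<in> K_carrier L meet \<zero>"
      by (simp_all add: K_defs zero_closed one_closed zero_least meet_zero)
  qed
qed

end

section \<open>Implication in a subresiduated lattice and in its algebra of disjoint pairs\<close>

context subresiduated_lattice
begin

text \<open>Since \<open>x \<rightarrow> _\<close> preserves meets and \<open>x = x \<sqinter> y\<close>, the element \<open>\<one> = x \<rightarrow> x = x \<rightarrow> (x \<sqinter> y)\<close> lies below \<open>x \<rightarrow> y\<close>.\<close>

lemma imp_eq_one_if_le:
  assumes "x \<in> A" "y \<in> A" "x \<sqsubseteq> y"
  shows "x \<rightarrow> y = \<one>"
proof -
  have "\<one> = \<one> \<sqinter> (x \<rightarrow> y)"
    using imp_meet[of x y x] assms imp_refl[of x] by simp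
  then show ?thesis
    using assms by (metis imp_closed meet_commute one_closed one_greatest)
qed

text \<open>By modus ponens \<open>a \<sqinter> (a \<rightarrow> c)\<close> lies below \<open>c\<close>.  This is why the implication of two disjoint
  pairs is again a disjoint pair.\<close>

lemma meet_imp_disjoint:
  assumes "a \<in> A" "c \<in> A" "d \<in> A" "c \<sqinter> d = \<zero>"
  shows "(a \<sqinter> (a \<rightarrow> c)) \<sqinter> d = \<zero>"
proof -
  have "(a \<sqinter> (a \<rightarrow> c)) \<sqinter> d = (a \<sqinter> (a \<rightarrow> c)) \<sqinter> (c \<sqinter> d)"
    using assms modus_ponens[of a c] by (metis imp_closed meet_assoc meet_closed)
  then show ?thesis
    using assms by (simp add: imp_closed meet_closed meet_zero)
qed

end

theorem proposition3p2:
  fixes A :: "'a set"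
    and meet join imp :: "'a \<Rightarrow> 'a \<Rightarrow> 'a"
    and zero one :: "'a"
  assumes "subresiduated_lattice A meet join imp zero one"
  shows "subresiduated_nelson_algebra (K_carrier A meet zero)
           (K_meet meet join) (K_join meet join) (K_imp meet imp) K_neg (zero, one) (one, zero)"
proof -
  interpret subresiduated_lattice A meet join imp zero one
    by (fact assms)
  interpret K: kleene_algebra "K_carrier A meet zero" "K_meet meet join" "K_join meet join" K_neg
    "(zero, one)" "(one, zero)"
    by (fact K_kleene_algebra)
  note K_defs = K_carrier_def K_meet_def K_join_def K_imp_def K_neg_def
  note closed = meet_closed join_closed imp_closed zero_closed one_closed
  show ?thesis
  proof
    fix x y
    assume "x \<in> K_carrier A meet zero" "y \<in> K_carrier A meet zero"
    then obtain a b c d where x: "x = (a, b)" and y: "y = (c, d)"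
      and mem: "a \<in> A" "b \<in> A" "c \<in> A" "d \<in> A"
      and ab: "meet a b = zero" and cd: "meet c d = zero"
      by (auto simp: K_carrier_def)
    have imp_disj: "meet (imp a c) (meet a d) = zero"
      using meet_imp_disjoint[of a c d] mem cd
      by (simp add: closed meet_assoc meet_left_commute)
    then show "K_imp meet imp x y \<in> K_carrier A meet zero"
      using mem by (simp add: x y K_defs closed)
    have mp: "meet (meet a (imp a c)) (meet a (join b c)) = meet a (imp a c)"
    proof -
      (* the disjunct b is lost because it is disjoint from a *)
      have "meet a (join b c) = meet a c"
        using mem ab by (simp add: meet_join_distrib zero_join closed)
      then show ?thesis
        using mem modus_ponens[of a c]
        by (metis closed(1,3) meet_assoc meet_commute meet_idem)
    qed
    show "K_meet meet join (K_meet meet join x (K_imp meet imp x y))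
        (K_meet meet join x (K_join meet join (K_neg x) y))
      = K_meet meet join x (K_imp meet imp x y)"
      using mem mp by (simp add: x y K_defs closed join_idem)
    have "meet (meet a d) (join b c) = zero"
      using meet_join_disjoint[of a b d c] mem ab cd by (simp add: meet_commute)
    then show "K_imp meet imp (K_neg (K_imp meet imp x y)) (K_meet meet join x (K_neg y))
      = (one, zero)"
      using mem by (simp add: x y K_defs closed imp_refl)
    show "K_imp meet imp (K_meet meet join x (K_neg y)) (K_neg (K_imp meet imp x y))
      = (one, zero)"
      using mem imp_disj meet_commute[of "imp a c" "meet a d"]
      by (simp add: x y K_defs closed imp_refl)
  next
    fix x
    assume "x \<in> K_carrier A meet zero"
    then show "K_imp meet imp x x = (one, zero)"
      by (auto simp: K_defs imp_refl)
  next
    fix x y z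
    assume "x \<in> K_carrier A meet zero" "y \<in> K_carrier A meet zero" "z \<in> K_carrier A meet zero"
    then obtain a b c d e f where x: "x = (a, b)" and y: "y = (c, d)" and z: "z = (e, f)"
      and mem: "a \<in> A" "b \<in> A" "c \<in> A" "d \<in> A" "e \<in> A" "f \<in> A"
      and cd: "meet c d = zero" and ef: "meet e f = zero"
      by (auto simp: K_carrier_def)
    show "K_imp meet imp (K_join meet join x y) z
      = K_meet meet join (K_imp meet imp x z) (K_imp meet imp y z)"
      using mem by (simp add: x y z K_defs join_imp join_meet_distrib_right)
    show "K_imp meet imp z (K_meet meet join x y)
      = K_meet meet join (K_imp meet imp z x) (K_imp meet imp z y)"
      using mem by (simp add: x y z K_defs imp_meet meet_join_distrib)
    let ?t = "meet (imp a c) (imp c e)"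
    have "imp ?t (imp a e) = one"
      using mem by (simp add: imp_eq_one_if_le imp_trans closed)
    moreover have "meet ?t (meet a f) = zero"
    proof -
      have "meet ?t (meet a f) = meet (meet ?t (imp a e)) (meet a f)"
        using mem by (simp add: imp_trans)
      also have "\<dots> = meet ?t (meet (meet a (imp a e)) f)"
        using mem by (simp add: closed meet_assoc meet_left_commute)
      also have "\<dots> = zero"
        using mem ef by (simp add: meet_imp_disjoint meet_zero closed)
      finally show ?thesis .
    qed
    ultimately show "K_imp meet imp
        (K_meet meet join (K_imp meet imp x y) (K_imp meet imp y z)) (K_imp meet imp x z)
      = (one, zero)"
      using mem by (simp add: x y z K_defs)
    have "join (meet a d) (meet e (meet a d)) = meet a d"
      using mem by (metis closed(1) join_meet_absorb meet_commute)
    then show "K_meet meet join (K_imp meet imp x y) (K_imp meet imp z (K_imp meet imp x y))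
      = K_imp meet imp x y"
      using mem by (simp add: x y z K_defs imp_weaken)
  qed
qed

end
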